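(* For every positive integer $n$, the set $B_{n+1}(231,321)$ is in bijection with $S_n(231,321)$; in particular $|B_{n+1}(231,321)|=|S_n(231,321)|$.
   Context: A permutation $\sigma\in S_n$ is written as $\sigma(1)\cdots\sigma(n)$. An index $i\in[n-1]$ is an ascent if $\sigma(i)<\sigma(i+1)$ and a descent if $\sigma(i)>\sigma(i+1)$. A ballot permutation is a permutation such that every prefix $\sigma(1)\cdots\sigma(p)$ has at least as many ascents as descents. $\sigma$ contains a pattern $\pi\in S_k$ if some subsequence $\sigma(c_1)\cdots\sigma(c_k)$ with $c_1<\dots<c_k$ is order-isomorphic to $\pi$, and avoids $\pi$ otherwise. $S_n(\pi_1,\dots,\pi_m)$ denotes the set of permutations of $[n]$ avoiding all of $\pi_1,\dots,\pi_m$, and $B_n(\pi_1,\dots,\pi_m)$ the set of ballot permutations of length $n$ avoiding all of them. *)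

theory Defs
  imports "HOL-Library.Sublist" "HOL-Combinatorics.Multiset_Permutations"
begin

text \<open>
  A permutation \<open>\<sigma>\<close> of \<open>{1..n}\<close> is represented by its one-line notation, the list
  \<open>[\<sigma>(1), ..., \<sigma>(n)]\<close>; the set of all of them is \<^term>\<open>permutations_of_set {1..n::nat}\<close>.
  Since list positions count from \<open>0\<close>, the entry \<open>\<sigma>(i)\<close> is \<^term>\<open>w ! (i - 1)\<close>.
\<close>

definition ascents :: "nat list \<Rightarrow> nat set" where
  "ascents w = {i \<in> {1..<length w}. w ! (i - 1) < w ! i}"

definition descents :: "nat list \<Rightarrow> nat set" where
  "descents w = {i \<in> {1..<length w}. w ! (i - 1) > w ! i}"

definition ballot :: "nat list \<Rightarrow> bool" where
  "ballot w \<longleftrightarrow>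
     (\<forall>p \<le> length w. card (ascents (take p w)) \<ge> card (descents (take p w)))"

definition order_isomorphic :: "nat list \<Rightarrow> nat list \<Rightarrow> bool" where
  "order_isomorphic u v \<longleftrightarrow>
     length u = length v \<and>
     (\<forall>i < length u. \<forall>j < length u. u ! i < u ! j \<longleftrightarrow> v ! i < v ! j)"

definition contains_pattern :: "nat list \<Rightarrow> nat list \<Rightarrow> bool" where
  "contains_pattern w pat \<longleftrightarrow> (\<exists>u. subseq u w \<and> order_isomorphic u pat)"

definition S_avoiding :: "nat \<Rightarrow> nat list set \<Rightarrow> nat list set" where
  "S_avoiding n P =
     {w \<in> permutations_of_set {1..n}. \<forall>pat \<in> P. \<not> contains_pattern w pat}"

definition B_avoiding :: "nat \<Rightarrow> nat list set \<Rightarrow> nat list set" where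
  "B_avoiding n P = {w \<in> S_avoiding n P. ballot w}"

end

theory Submission
  imports Defs
begin

text \<open>
  The bijection is \<open>\<sigma> \<mapsto> 1 \<oplus> \<sigma>\<close>. A permutation avoiding 231 that does not start with 1
  must start with a descent, since an initial ascent together with the entry 1 would form
  a 231; so a ballot one starts with 1. Conversely, prepending 1 creates neither pattern, and in
  \<open>1 \<oplus> \<sigma>\<close> every descent is immediately preceded by an ascent, because two consecutive
  descents form a 321 and the first step goes up.
\<close>

lemma order_isomorphic_231_iff:
  "order_isomorphic [a, b, c] [2, 3, 1] \<longleftrightarrow> c < a \<and> a < b"
  by (auto simp: order_isomorphic_def All_less_Suc numeral_3_eq_3)

lemma order_isomorphic_321_iff:
  "order_isomorphic [a, b, c] [3, 2, 1] \<longleftrightarrow> c < b \<and> b < a"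
  by (auto simp: order_isomorphic_def All_less_Suc numeral_3_eq_3)

lemma order_isomorphic_map:
  assumes "strict_mono f"
  shows "order_isomorphic (map f u) pat \<longleftrightarrow> order_isomorphic u pat"
  using strict_mono_less[OF assms] by (auto simp: order_isomorphic_def)

lemma subseq_map_iff:
  "subseq u (map f w) \<longleftrightarrow> (\<exists>v. subseq v w \<and> u = map f v)"
  unfolding subseq_conv_nths nths_map by auto

lemma contains_pattern_map:
  assumes "strict_mono f"
  shows "contains_pattern (map f w) pat \<longleftrightarrow> contains_pattern w pat"
  unfolding contains_pattern_def subseq_map_iff
  using order_isomorphic_map[OF assms] by metis

text \<open>An occurrence that uses the new leading entry has it in the role of \<open>p\<close>.
  Some later letter of the pattern lies below \<open>p\<close>, so an entry of \<open>w\<close>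
  would have to lie below \<open>m\<close>.\<close>

lemma contains_pattern_Cons_minimum:
  assumes "\<forall>x \<in> set w. m \<le> x" and "\<exists>q \<in> set pat. q < p"
  shows "contains_pattern (m # w) (p # pat) \<longleftrightarrow> contains_pattern w (p # pat)"
proof
  assume "contains_pattern (m # w) (p # pat)"
  then obtain u where u: "subseq u (m # w)" and iso: "order_isomorphic u (p # pat)"
    by (auto simp: contains_pattern_def)
  have "subseq u w"
  proof (rule ccontr)
    assume "\<not> subseq u w"
    with u obtain v where v: "u = m # v" "subseq v w"
      by (cases u) (auto split: if_splits)
    from assms(2) obtain j where j: "j < length pat" "pat ! j < p"
      by (auto simp: in_set_conv_nth)
    from iso have len: "length v = length pat"
      and "\<forall>i < length u. \<forall>k < length u. u ! i < u ! k \<longleftrightarrow> (p # pat) ! i < (p # pat) ! k"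
      using v by (auto simp: order_isomorphic_def)
    from this(2)[rule_format, of "Suc j" 0] have "v ! j < m"
      using j v len by simp
    moreover have "set v \<subseteq> set w"
      using v(2) by (auto simp: subseq_conv_nths dest: in_set_nthsD)
    then have "v ! j \<in> set w"
      using j(1) len by auto
    ultimately show False
      using assms(1) by fastforce
  qed
  then show "contains_pattern w (p # pat)"
    using iso by (auto simp: contains_pattern_def)
next
  assume "contains_pattern w (p # pat)"
  then show "contains_pattern (m # w) (p # pat)"
    unfolding contains_pattern_def by (meson list_emb_Cons)
qed

lemma Cons_map_Suc_in_permutations_of_set_iff:
  "1 # map Suc s \<in> permutations_of_set {1..n + 1} \<longleftrightarrow> s \<in> permutations_of_set {1..n}"
proof (cases "0 \<in> set s")
  \<comment> \<open>A 0 in \<open>s\<close> becomes a second 1 after the shift, so both sides are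
    false.\<close>
  case True
  then show ?thesis
    by (auto simp: permutations_of_set_def)
next
  case False
  then have "1 \<notin> set (map Suc s)"
    by auto
  moreover have "{1..n + 1} = insert 1 (Suc ` {1..n})"
    unfolding image_Suc_atLeastAtMost by auto
  ultimately have "set (1 # map Suc s) = {1..n + 1} \<longleftrightarrow> set (map Suc s) = Suc ` {1..n}"
    by (simp only: list.set(2)) (rule insert_ident; force)
  also have "\<dots> \<longleftrightarrow> set s = {1..n}"
    by (simp only: set_map inj_image_eq_iff[OF inj_Suc])
  finally show ?thesis
    using \<open>1 \<notin> set (map Suc s)\<close> by (simp add: permutations_of_set_def distinct_map)
qed

text \<open>In both patterns the first letter is followed by the smaller letter 1, so a leading
  minimum takes part in no occurrence, and shifting by \<open>Suc\<close> preserves order. As an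
  equivalence it gives both that the map lands in the right set and that preimages avoid the
  patterns.\<close>

lemma Cons_map_Suc_in_S_avoiding_iff:
  "1 # map Suc s \<in> S_avoiding (n + 1) {[2,3,1], [3,2,1]} \<longleftrightarrow> s \<in> S_avoiding n {[2,3,1], [3,2,1]}"
proof -
  have "contains_pattern (1 # map Suc s) (p # pat) \<longleftrightarrow> contains_pattern s (p # pat)"
    if "\<exists>q \<in> set pat. q < p" for p pat
    using that contains_pattern_Cons_minimum[of "map Suc s" 1 pat p]
    by (simp add: contains_pattern_map strict_mono_def)
  then show ?thesis
    unfolding S_avoiding_def using Cons_map_Suc_in_permutations_of_set_iff by auto
qed

lemma avoids_321_no_double_descent:
  assumes "\<not> contains_pattern w [3,2,1]" and "Suc (Suc i) < length w" and "w ! Suc i < w ! i"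
  shows "w ! Suc i \<le> w ! Suc (Suc i)"
proof (rule ccontr)
  assume "\<not> w ! Suc i \<le> w ! Suc (Suc i)"
  then have "order_isomorphic [w ! i, w ! Suc i, w ! Suc (Suc i)] [3, 2, 1]"
    using assms(3) by (simp only: order_isomorphic_321_iff) simp
  \<comment> \<open>The three entries form a contiguous block of \<open>w\<close>, hence a
    subsequence.\<close>
  moreover have "drop i w = [w ! i, w ! Suc i, w ! Suc (Suc i)] @ drop (Suc (Suc (Suc i))) w"
    using assms(2) by (simp add: Cons_nth_drop_Suc)
  then have "subseq [w ! i, w ! Suc i, w ! Suc (Suc i)] w"
    by (metis append_take_drop_id list_emb_append2 subseq_rev_drop_many subseq_order.order_refl)
  ultimately show False
    using assms(1) by (auto simp: contains_pattern_def)
qed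

text \<open>Within each prefix, \<open>i \<mapsto> i - 1\<close> injects the descents into the
  ascents.\<close>

lemma ballot_Cons_minimum:
  assumes "distinct (m # w)" and "\<forall>x \<in> set w. m \<le> x"
    and "\<not> contains_pattern (m # w) [3,2,1]"
  shows "ballot (m # w)"
  unfolding ballot_def
proof (intro allI impI)
  let ?w = "m # w"
  fix p assume p: "p \<le> length ?w"
  have pred: "i \<ge> 1 \<and> i - 1 \<in> ascents (take p ?w)" if "i \<in> descents (take p ?w)" for i
  proof -
    from that p have i: "1 \<le> i" "i < p" "?w ! i < ?w ! (i - 1)"
      by (auto simp: descents_def)
    \<comment> \<open>Index 1 compares \<open>m\<close> with the first entry of \<open>w\<close>,
      and \<open>m\<close> is minimal.\<close>
    have "i \<noteq> 1"
      using i p assms(2) nth_mem[of 0 w] by fastforce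
    with i(1) obtain k where k: "i = Suc (Suc k)"
      by (metis Suc_1 add_2_eq_Suc le_Suc_ex le_antisym not_less_eq_eq)
    have "Suc (Suc k) < length ?w" and "?w ! Suc (Suc k) < ?w ! Suc k"
      using i p k by simp_all
    then have "?w ! k \<le> ?w ! Suc k"
      using avoids_321_no_double_descent[OF assms(3), of k] by (meson not_le)
    moreover have "?w ! Suc k \<noteq> ?w ! k"
      using assms(1) \<open>Suc (Suc k) < length ?w\<close> by (subst nth_eq_iff_index_eq) simp_all
    ultimately have "?w ! k < ?w ! Suc k"
      by linarith
    then show ?thesis
      using i(2) p unfolding k ascents_def by simp
  qed
  show "card (descents (take p ?w)) \<le> card (ascents (take p ?w))"
  proof (rule card_inj_on_le)
    \<comment> \<open>Subtraction on naturals is truncated; it is injective here because descents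
      are at least 1.\<close>
    show "inj_on (\<lambda>i. i - 1) (descents (take p ?w))"
      using pred by (meson eq_diff_iff inj_onI)
    show "(\<lambda>i. i - 1) ` descents (take p ?w) \<subseteq> ascents (take p ?w)"
      using pred by blast
    show "finite (ascents (take p ?w))"
      by (simp add: ascents_def)
  qed
qed

text \<open>Otherwise the prefix of length 2 has one descent and no ascent.\<close>

lemma ballot_no_initial_descent:
  assumes "ballot (a # b # w)"
  shows "a \<le> b"
proof (rule ccontr)
  assume "\<not> a \<le> b"
  then have "ascents [a, b] = {}" "descents [a, b] = {1}"
    by (auto simp: ascents_def descents_def)
  moreover have "card (descents (take 2 (a # b # w))) \<le> card (ascents (take 2 (a # b # w)))"
    using assms unfolding ballot_def by (metis Suc_le_mono le0 length_Cons numeral_2_eq_2)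
  ultimately show False
    by simp
qed

lemma ballot_avoids_231_hd_minimum:
  assumes "ballot w" and "\<not> contains_pattern w [2,3,1]" and "distinct w" and "x \<in> set w"
  shows "hd w \<le> x"
proof (rule ccontr)
  assume x: "\<not> hd w \<le> x"
  with assms(4) obtain a b r where w: "w = a # b # r"
    by (metis list.exhaust list.sel(1) order_refl set_ConsD empty_iff empty_set)
  have ab: "a < b"
    using ballot_no_initial_descent assms(1,3) w by fastforce
  \<comment> \<open>Being smaller than both \<open>a\<close> and \<open>b\<close>, the entry
    \<open>x\<close> must occur after them and completes a 231.\<close>
  with x assms(4) w have "x \<in> set r" "x < a"
    by auto
  then have "subseq [a, b, x] w"
    using w by (simp add: subseq_singleton_left)
  moreover have "order_isomorphic [a, b, x] [2, 3, 1]"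
    using ab \<open>x < a\<close> by (simp only: order_isomorphic_231_iff)
  ultimately show False
    using assms(2) by (auto simp: contains_pattern_def)
qed

lemma bij_betw_S_avoiding_B_avoiding:
  "bij_betw (\<lambda>s. 1 # map Suc s)
     (S_avoiding n {[2,3,1], [3,2,1]}) (B_avoiding (n + 1) {[2,3,1], [3,2,1]})"
  unfolding bij_betw_def
proof
  show "inj_on (\<lambda>s. 1 # map Suc s) (S_avoiding n {[2,3,1], [3,2,1]})"
    by (auto simp: inj_on_def)
  show "(\<lambda>s. 1 # map Suc s) ` S_avoiding n {[2,3,1], [3,2,1]} = B_avoiding (n + 1) {[2,3,1], [3,2,1]}"
  proof (intro equalityI subsetI)
    fix w assume "w \<in> (\<lambda>s. 1 # map Suc s) ` S_avoiding n {[2,3,1], [3,2,1]}"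
    then obtain s where w: "w = 1 # map Suc s" "s \<in> S_avoiding n {[2,3,1], [3,2,1]}"
      by blast
    then have S: "w \<in> S_avoiding (n + 1) {[2,3,1], [3,2,1]}"
      using Cons_map_Suc_in_S_avoiding_iff by blast
    then have "ballot w"
      unfolding w(1) by (intro ballot_Cons_minimum)
        (auto simp: S_avoiding_def permutations_of_set_def)
    with S show "w \<in> B_avoiding (n + 1) {[2,3,1], [3,2,1]}"
      by (simp add: B_avoiding_def)
  next
    fix w assume B: "w \<in> B_avoiding (n + 1) {[2,3,1], [3,2,1]}"
    then have w: "ballot w" "\<not> contains_pattern w [2,3,1]" "distinct w" "set w = {1..n + 1}"
      by (auto simp: B_avoiding_def S_avoiding_def permutations_of_set_def)
    then obtain a v where v: "w = a # v"
      by (cases w) auto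
    have "a = 1"
      using ballot_avoids_231_hd_minimum[OF w(1-3), of 1] w(4) v by fastforce
    \<comment> \<open>The preimage of \<open>w\<close> is its tail lowered by 1; no entry is 0, so
      \<open>Suc\<close> undoes the truncated subtraction.\<close>
    moreover have "map Suc (map (\<lambda>x. x - 1) v) = v"
    proof -
      have "0 \<notin> set v"
        using w(4) v by (metis atLeastAtMost_iff list.set_intros(2) not_one_le_zero)
      then show ?thesis
        unfolding map_map by (intro map_idI) (metis One_nat_def Suc_pred comp_apply neq0_conv)
    qed
    ultimately have "w = 1 # map Suc (map (\<lambda>x. x - 1) v)"
      using v by simp
    then show "w \<in> (\<lambda>s. 1 # map Suc s) ` S_avoiding n {[2,3,1], [3,2,1]}"
      using B Cons_map_Suc_in_S_avoiding_iff
      by (metis (no_types, lifting) B_avoiding_def image_eqI mem_Collect_eq)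
  qed
qed

theorem theorem3p13:
  fixes n :: nat
  assumes "n \<ge> 1"
  shows "(\<exists>f. bij_betw f (B_avoiding (n + 1) {[2,3,1], [3,2,1]}) (S_avoiding n {[2,3,1], [3,2,1]})) \<and>
         card (B_avoiding (n + 1) {[2,3,1], [3,2,1]}) = card (S_avoiding n {[2,3,1], [3,2,1]})"
  \<comment> \<open>The statement asks for a map out of the ballot permutations, so the inverse,
    which deletes the leading 1 and lowers the rest, is taken.\<close>
  using bij_betw_inv_into[OF bij_betw_S_avoiding_B_avoiding]
    bij_betw_same_card[OF bij_betw_S_avoiding_B_avoiding] by metis

end
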